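(* Suppose $\mu:=\min\{\mu_p,\mu_d\}>0$. Let $z^*$ be the unique saddle point of $\min_{x\in X}\max_{y\in Y}F(x,y)$. Choose $\eta_t=1/L$ in the REG method (defined in the context), started from $z_0\in Z$. Then $$\|z_T-z^*\|^2\le\left(1+\frac\mu L\right)^{-T}\|z_0-z^*\|^2 .$$
   Context: Setting: $X$ and $Y$ are compact convex sets, $Z=X\times Y$, $z=(x,y)$; $\|\cdot\|$ is a norm and $\|\cdot\|_*$ its dual norm. $F:X\times Y\to\mathbb R$ is differentiable with $L$-Lipschitz gradient, $L>0$: $\|\nabla F(x,y)-\nabla F(x',y')\|_*\le L\|(x,y)-(x',y')\|$. For some $\mu_p,\mu_d>0$: $F(x_1,y)-F(x_2,y)-\langle\nabla_xF(x_2,y),x_1-x_2\rangle\ge\frac{\mu_p}{2}\|x_1-x_2\|^2$ for all $x_1,x_2\in X$ (and $y\in Y$), and $F(x,y_1)-F(x,y_2)-\langle\nabla_yF(x,y_2),y_1-y_2\rangle\le-\frac{\mu_d}{2}\|y_1-y_2\|^2$ for all $y_1,y_2\in Y$ (and $x\in X$). REG (regularized extragradient) method: let $G(z)=[\nabla_xF(z);-\nabla_yF(z)]$. Given $z_0\in Z$, stepsizes $\{\eta_t\}$ and a number of steps $T>0$, for $t=0,1,\dots,T-1$: $$\hat z_t=\arg\min_{z\in Z}\ \eta_t\langle G(z_t),z\rangle+\tfrac12\|z-z_t\|^2,$$ $$z_{t+1}=\arg\min_{z\in Z}\ \eta_t\left[\langle G(\hat z_t),z\rangle+\tfrac\mu2\|z-\hat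 z_t\|^2\right]+\tfrac12\|z-z_t\|^2 .$$
   Formalization: The claim fails for general norms (e.g. the maximum norm), so the norms on x and y are required to come from inner products (in finite dimensions), with ‖(x,y)‖² = ‖x‖² + ‖y‖². *)

theory Defs
  imports "HOL-Analysis.Analysis"
begin

text \<open>
  The bracket \<open>\<langle>g, v\<rangle>\<close> is the standard inner product \<open>g \<bullet> v\<close>.  The norm need not be the
  one of the type class, so it is a function \<open>N\<close> of its own, with a dual norm in general different
  from \<open>N\<close>.  The prox-function \<open>(1/2) N(z - z\<^sub>t)\<^sup>2\<close> of the regularized extragradient method calls for
  a norm that comes from some inner product \<open>B\<close>: the convergence estimate is false for
  arbitrary norms, such as the maximum norm.
\<close>

definition inner_product_norm :: "('a::real_vector \<Rightarrow> real) \<Rightarrow> bool" where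
  "inner_product_norm N \<longleftrightarrow>
    (\<exists>B. bilinear B \<and> (\<forall>u v. B u v = B v u) \<and> (\<forall>v. v \<noteq> 0 \<longrightarrow> B v v > 0) \<and>
         (\<forall>v. N v = sqrt (B v v)))"

definition dual_norm :: "('a::euclidean_space \<Rightarrow> real) \<Rightarrow> 'a \<Rightarrow> real" where
  "dual_norm N g = (SUP v\<in>{v. N v \<le> 1}. g \<bullet> v)"

definition prod_norm :: "('a \<Rightarrow> real) \<Rightarrow> ('b \<Rightarrow> real) \<Rightarrow> 'a \<times> 'b \<Rightarrow> real" where
  "prod_norm nX nY z = sqrt ((nX (fst z))\<^sup>2 + (nY (snd z))\<^sup>2)"

definition saddle_point :: "('a \<times> 'b \<Rightarrow> real) \<Rightarrow> 'a set \<Rightarrow> 'b set \<Rightarrow> 'a \<times> 'b \<Rightarrow> bool" where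
  "saddle_point F X Y z \<longleftrightarrow> z \<in> X \<times> Y \<and>
    (\<forall>y\<in>Y. F (fst z, y) \<le> F z) \<and> (\<forall>x\<in>X. F z \<le> F (x, snd z))"

text \<open>Below, \<open>D z = (\<nabla>\<^sub>x F(z), \<nabla>\<^sub>y F(z))\<close> is the gradient of \<open>F\<close>.\<close>

definition saddle_operator ::
    "('a \<times> 'b \<Rightarrow> 'a \<times> 'b) \<Rightarrow> 'a \<times> 'b \<Rightarrow> 'a \<times> 'b::ab_group_add" where
  "saddle_operator D z = (fst (D z), - snd (D z))"

definition REG_iterates ::
    "('z::real_inner \<Rightarrow> real) \<Rightarrow> 'z set \<Rightarrow> ('z \<Rightarrow> 'z) \<Rightarrow> real \<Rightarrow> (nat \<Rightarrow> real) \<Rightarrow> nat \<Rightarrow>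
     'z \<Rightarrow> (nat \<Rightarrow> 'z) \<Rightarrow> (nat \<Rightarrow> 'z) \<Rightarrow> bool" where
  "REG_iterates N Z G \<mu> \<eta> T z0 z zhat \<longleftrightarrow>
    z 0 = z0 \<and>
    (\<forall>t<T.
       is_arg_min (\<lambda>w. \<eta> t * (G (z t) \<bullet> w) + 1/2 * (N (w - z t))\<^sup>2)
         (\<lambda>w. w \<in> Z) (zhat t) \<and>
       is_arg_min (\<lambda>w. \<eta> t * (G (zhat t) \<bullet> w + \<mu>/2 * (N (w - zhat t))\<^sup>2)
                        + 1/2 * (N (w - z t))\<^sup>2)
         (\<lambda>w. w \<in> Z) (z (Suc t)))"

end

theory Submission
  imports Defs
begin

text \<open>
  Each of the two proximal steps of an iteration minimises a strongly convex function, so its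
  minimiser satisfies a three-point inequality.  Write \<open>v\<^sub>t\<close> for the extrapolated point.  Compare
  \<open>v\<^sub>t\<close> with \<open>z\<^sub>t\<^sub>+\<^sub>1\<close> and \<open>z\<^sub>t\<^sub>+\<^sub>1\<close> with \<open>z\<^sup>*\<close>, and add.  The error
  \<open>\<langle>G(v\<^sub>t) - G(z\<^sub>t), v\<^sub>t - z\<^sub>t\<^sub>+\<^sub>1\<rangle>\<close> is absorbed by the quadratic terms because \<open>\<eta>L = 1\<close>, and the
  regularization term \<open>(\<mu>/2)\<parallel>z\<^sup>* - v\<^sub>t\<parallel>\<^sup>2\<close> by \<open>\<langle>G(v\<^sub>t), v\<^sub>t - z\<^sup>*\<rangle> \<ge> (\<mu>/2)\<parallel>v\<^sub>t - z\<^sup>*\<parallel>\<^sup>2\<close>, leaving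
  \<open>(1 + \<mu>/L)\<parallel>z\<^sub>t\<^sub>+\<^sub>1 - z\<^sup>*\<parallel>\<^sup>2 \<le> \<parallel>z\<^sub>t - z\<^sup>*\<parallel>\<^sup>2\<close>.
\<close>

section \<open>Norms induced by an inner product, and their duals\<close>

lemma inner_product_norm_bilinear:
  assumes "inner_product_norm N"
  shows "\<exists>B. bilinear B \<and> (\<forall>u v. B u v = B v u) \<and> (\<forall>v. v \<noteq> 0 \<longrightarrow> B v v > 0) \<and>
           (\<forall>v. N v = sqrt (B v v)) \<and> (\<forall>v. (N v)\<^sup>2 = B v v)"
proof -
  from assms obtain B where B: "bilinear B" "\<forall>u v. B u v = B v u" "\<forall>v. v \<noteq> 0 \<longrightarrow> B v v > 0"
    "\<forall>v. N v = sqrt (B v v)"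
    unfolding inner_product_norm_def by blast
  have "B v v \<ge> 0" for v
    using B(3) bilinear_lzero[OF B(1)] by (cases "v = 0") (auto simp: less_imp_le)
  then have "\<forall>v. (N v)\<^sup>2 = B v v"
    using B(4) by simp
  with B show ?thesis by blast
qed

lemma inner_product_norm_pos:
  "inner_product_norm N \<Longrightarrow> v \<noteq> 0 \<Longrightarrow> N v > 0"
  using inner_product_norm_bilinear[of N] by auto

lemma inner_product_norm_scaleR:
  assumes "inner_product_norm N"
  shows "N (c *\<^sub>R v) = \<bar>c\<bar> * N v"
proof -
  obtain B where B: "bilinear B" "\<And>u v. B u v = B v u" "\<And>v. v \<noteq> 0 \<Longrightarrow> B v v > 0"
    "\<And>v. N v = sqrt (B v v)" "\<And>v. (N v)\<^sup>2 = B v v"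
    using inner_product_norm_bilinear[OF assms] by blast
  show ?thesis
    by (simp add: B(4) bilinear_lmul[OF B(1)] bilinear_rmul[OF B(1)] real_sqrt_mult
        flip: mult.assoc)
qed

lemma inner_product_norm_nonneg:
  assumes "inner_product_norm N"
  shows "N v \<ge> 0"
  using inner_product_norm_pos[OF assms, of v] inner_product_norm_scaleR[OF assms, of 0 v]
  by (cases "v = 0") auto

lemma inner_product_norm_minus_commute:
  assumes "inner_product_norm N"
  shows "N (u - v) = N (v - u)"
  using inner_product_norm_scaleR[OF assms, of "-1" "u - v"] by simp

text \<open>Expansion of the bilinear form; at \<open>s = 1/2\<close> this is the parallelogram law,
  so it is here that the norm has to come from an inner product.\<close>

lemma inner_product_norm_convex_comb:
  assumes "inner_product_norm N"
  shows "(N ((1 - s) *\<^sub>R p + s *\<^sub>R w - u))\<^sup>2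
           = (1 - s) * (N (p - u))\<^sup>2 + s * (N (w - u))\<^sup>2 - s * (1 - s) * (N (w - p))\<^sup>2"
proof -
  obtain B where B: "bilinear B" "\<And>u v. B u v = B v u" "\<And>v. v \<noteq> 0 \<Longrightarrow> B v v > 0"
    "\<And>v. N v = sqrt (B v v)" "\<And>v. (N v)\<^sup>2 = B v v"
    using inner_product_norm_bilinear[OF assms] by blast
  note bil = bilinear_ladd[OF B(1)] bilinear_radd[OF B(1)] bilinear_lsub[OF B(1)]
    bilinear_rsub[OF B(1)] bilinear_lmul[OF B(1)] bilinear_rmul[OF B(1)]
  show ?thesis
    unfolding B(5)
    by (simp add: bil B(2)[of p w] B(2)[of u w] B(2)[of u p]) (simp add: algebra_simps)
qed

text \<open>By compactness \<open>N\<close> attains a positive minimum on the Euclidean unit sphere,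
  and homogeneity extends the bound. This makes the unit ball of \<open>N\<close> bounded, so that
  the dual norm is a genuine supremum.\<close>

lemma inner_product_norm_lower_bound:
  fixes N :: "'a::euclidean_space \<Rightarrow> real"
  assumes N: "inner_product_norm N"
  obtains c where "c > 0" "\<And>v. c * norm v \<le> N v"
proof -
  obtain B where B: "bilinear B" "\<And>u v. B u v = B v u" "\<And>v. v \<noteq> 0 \<Longrightarrow> B v v > 0"
    "\<And>v. N v = sqrt (B v v)" "\<And>v. (N v)\<^sup>2 = B v v"
    using inner_product_norm_bilinear[OF N] by blast
  have "bounded_bilinear B"
    using B(1) by (simp add: bilinear_conv_bounded_bilinear)
  then have "continuous_on (sphere 0 1) (\<lambda>v. B v v)"
    by (rule bounded_bilinear.continuous_on[OF _ continuous_on_id continuous_on_id])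
  then have "continuous_on (sphere 0 1) N"
    unfolding B(4) by (rule continuous_on_real_sqrt)
  moreover have "sphere (0::'a) 1 \<noteq> {}"
    by simp
  ultimately obtain v0 where v0: "v0 \<in> sphere 0 1" "\<And>v. v \<in> sphere 0 1 \<Longrightarrow> N v0 \<le> N v"
    using continuous_attains_inf[of "sphere (0::'a) 1" N] by auto
  have "N v0 * norm v \<le> N v" for v
  proof (cases "v = 0")
    case True
    then show ?thesis using inner_product_norm_nonneg[OF N] by simp
  next
    case False
    then have "N v0 \<le> N ((1 / norm v) *\<^sub>R v)"
      by (intro v0(2)) simp
    with False show ?thesis
      by (simp add: inner_product_norm_scaleR[OF N] field_simps)
  qed
  moreover have "N v0 > 0"
    using v0(1) by (intro inner_product_norm_pos[OF N]) auto
  ultimately show thesis using that by blast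
qed

lemma inner_le_dual_norm:
  fixes N :: "'a::euclidean_space \<Rightarrow> real"
  assumes N: "inner_product_norm N"
  shows "g \<bullet> v \<le> dual_norm N g * N v"
proof (cases "v = 0")
  case True
  then show ?thesis
    using inner_product_norm_scaleR[OF N, of 0 0] by simp
next
  case False
  obtain c where c: "c > 0" "\<And>v. c * norm v \<le> N v"
    using inner_product_norm_lower_bound[OF N] by blast
  \<comment> \<open>A real \<open>SUP\<close> dominates its members only if the set is bounded
    above; Cauchy-Schwarz on the unit ball of \<open>N\<close> supplies the bound.\<close>
  have bdd: "bdd_above ((\<lambda>v. g \<bullet> v) ` {v. N v \<le> 1})"
  proof (rule bdd_aboveI2)
    fix v assume "v \<in> {v. N v \<le> 1}"
    with c(2)[of v] have "c * norm v \<le> 1" by simp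
    with c(1) have "norm v \<le> 1 / c" by (simp add: field_simps)
    then have "norm g * norm v \<le> norm g * (1 / c)"
      by (intro mult_left_mono) auto
    with norm_cauchy_schwarz[of g v] show "g \<bullet> v \<le> norm g * (1 / c)"
      by linarith
  qed
  have pos: "N v > 0"
    using N False by (rule inner_product_norm_pos)
  then have "N ((1 / N v) *\<^sub>R v) \<le> 1"
    by (simp add: inner_product_norm_scaleR[OF N])
  then have "g \<bullet> ((1 / N v) *\<^sub>R v) \<le> dual_norm N g"
    unfolding dual_norm_def by (intro cSUP_upper bdd) simp
  with pos show ?thesis
    by (simp add: field_simps)
qed

text \<open>The inducing form is the orthogonal direct sum \<open>E\<close> of the two given
  ones.\<close>

lemma inner_product_norm_prod_norm:
  assumes "inner_product_norm nX" "inner_product_norm nY"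
  shows "inner_product_norm (prod_norm nX nY)"
proof -
  obtain B where B: "bilinear B" "\<And>u v. B u v = B v u" "\<And>v. v \<noteq> 0 \<Longrightarrow> B v v > 0"
    "\<And>v. nX v = sqrt (B v v)" "\<And>v. (nX v)\<^sup>2 = B v v"
    using inner_product_norm_bilinear[OF assms(1)] by blast
  obtain C where C: "bilinear C" "\<And>u v. C u v = C v u" "\<And>v. v \<noteq> 0 \<Longrightarrow> C v v > 0"
    "\<And>v. nY v = sqrt (C v v)" "\<And>v. (nY v)\<^sup>2 = C v v"
    using inner_product_norm_bilinear[OF assms(2)] by blast
  define E where "E u v = B (fst u) (fst v) + C (snd u) (snd v)" for u v
  note bil = bilinear_ladd[OF B(1)] bilinear_radd[OF B(1)] bilinear_lmul[OF B(1)]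
    bilinear_rmul[OF B(1)] bilinear_ladd[OF C(1)] bilinear_radd[OF C(1)]
    bilinear_lmul[OF C(1)] bilinear_rmul[OF C(1)]
  have "bilinear E"
    unfolding bilinear_def E_def by (auto intro!: linearI simp: bil algebra_simps)
  moreover have "E u v = E v u" for u v
    unfolding E_def using B(2) C(2) by metis
  moreover have "E v v > 0" if "v \<noteq> 0" for v
  proof -
    have "B (fst v) (fst v) \<ge> 0" "C (snd v) (snd v) \<ge> 0"
      by (simp_all flip: B(5) C(5))
    moreover have "fst v \<noteq> 0 \<or> snd v \<noteq> 0"
      using that by (simp add: prod_eq_iff)
    ultimately show ?thesis
      unfolding E_def using B(3) C(3) by (metis add_nonneg_pos add_pos_nonneg)
  qed
  moreover have "prod_norm nX nY v = sqrt (E v v)" for v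
    by (simp add: prod_norm_def E_def B(5) C(5))
  ultimately show ?thesis
    unfolding inner_product_norm_def by blast
qed

section \<open>Optimality of a proximal step\<close>

text \<open>Along the segment from \<open>p\<close> to \<open>w\<close> the objective is a quadratic
  in \<open>s\<close> whose curvature is known exactly; minimality at \<open>p\<close> turns that
  curvature into the extra term. Two centres \<open>u\<close> and \<open>v\<close> are allowed so
  that the regularized step is covered too.\<close>

lemma prox_three_point:
  assumes N: "inner_product_norm N" and Z: "convex Z" "w \<in> Z"
    and p: "is_arg_min (\<lambda>w. g \<bullet> w + a * (N (w - u))\<^sup>2 + b * (N (w - v))\<^sup>2) (\<lambda>w. w \<in> Z) p"
  shows "g \<bullet> p + a * (N (p - u))\<^sup>2 + b * (N (p - v))\<^sup>2 + (a + b) * (N (w - p))\<^sup>2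
           \<le> g \<bullet> w + a * (N (w - u))\<^sup>2 + b * (N (w - v))\<^sup>2"
proof -
  define f where "f w = g \<bullet> w + a * (N (w - u))\<^sup>2 + b * (N (w - v))\<^sup>2" for w
  define d where "d = (a + b) * (N (w - p))\<^sup>2"
  have pZ: "p \<in> Z" and min: "f p \<le> f y" if "y \<in> Z" for y
    using p that unfolding is_arg_min_def f_def by (auto simp: not_less)
  have bound: "f p + (1 - s) * d \<le> f w" if s: "0 < s" "s < 1" for s
  proof -
    have "f p \<le> f ((1 - s) *\<^sub>R p + s *\<^sub>R w)"
      using Z pZ[OF Z(2)] s by (intro min convexD) auto
    also have "\<dots> = (1 - s) * f p + s * f w - s * (1 - s) * d"
      unfolding f_def inner_product_norm_convex_comb[OF N] d_def
      by (simp add: inner_add_right algebra_simps)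
    finally have "s * (f p + (1 - s) * d) \<le> s * f w"
      by (simp add: algebra_simps)
    with s show ?thesis by simp
  qed
  \<comment> \<open>Dividing by \<open>s\<close> required \<open>s > 0\<close>, so the full term
    \<open>d\<close> is reached only in the limit from the right.\<close>
  have "((\<lambda>s. f p + (1 - s) * d) \<longlongrightarrow> f p + (1 - 0) * d) (at_right 0)"
    by (intro tendsto_intros)
  moreover have "\<forall>\<^sub>F s in at_right 0. f p + (1 - s) * d \<le> f w"
    using eventually_at_right_real[OF zero_less_one] by eventually_elim (auto intro: bound)
  ultimately have "f p + (1 - 0) * d \<le> f w"
    by (rule tendsto_upperbound) simp
  then show ?thesis
    by (simp add: f_def d_def)
qed

section \<open>Properties of the saddle operator\<close>

lemma prod_norm_power2: "(prod_norm nX nY v)\<^sup>2 = (nX (fst v))\<^sup>2 + (nY (snd v))\<^sup>2"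
  by (simp add: prod_norm_def)

text \<open>The sign change in the second component can be moved to \<open>v\<close>, where it
  preserves the product norm; a Lipschitz bound on \<open>D\<close> thus serves for the
  operator.\<close>

lemma saddle_operator_inner_le_dual_norm:
  fixes D :: "'a::euclidean_space \<times> 'b::euclidean_space \<Rightarrow> 'a \<times> 'b"
  assumes "inner_product_norm nX" and nY: "inner_product_norm nY"
  shows "(saddle_operator D w - saddle_operator D w') \<bullet> v
           \<le> dual_norm (prod_norm nX nY) (D w - D w') * prod_norm nX nY v"
proof -
  have "(saddle_operator D w - saddle_operator D w') \<bullet> v = (D w - D w') \<bullet> (fst v, - snd v)"
    by (simp add: saddle_operator_def inner_prod_def inner_diff_left)
  also have "\<dots> \<le> dual_norm (prod_norm nX nY) (D w - D w') * prod_norm nX nY (fst v, - snd v)"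
    using assms by (intro inner_le_dual_norm inner_product_norm_prod_norm)
  also have "prod_norm nX nY (fst v, - snd v) = prod_norm nX nY v"
    using inner_product_norm_scaleR[OF nY, of "-1" "snd v"] by (simp add: prod_norm_def)
  finally show ?thesis .
qed

text \<open>Both curvature inequalities are taken with the gradient at \<open>w\<close>. Their
  difference contains the gap \<open>F (x, ys) - F (xs, y)\<close>, which is nonnegative because
  \<open>F (xs, ys)\<close> lies between the two values.\<close>

lemma saddle_operator_strongly_coercive:
  assumes sp: "saddle_point F X Y zs" and w: "w \<in> X \<times> Y"
    and mu: "\<mu> \<le> \<mu>\<^sub>p" "\<mu> \<le> \<mu>\<^sub>d"
    and convF: "\<And>x1 x2 y. x1 \<in> X \<Longrightarrow> x2 \<in> X \<Longrightarrow> y \<in> Y \<Longrightarrow>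
           F (x1, y) - F (x2, y) - fst (D (x2, y)) \<bullet> (x1 - x2) \<ge> \<mu>\<^sub>p / 2 * (nX (x1 - x2))\<^sup>2"
    and concF: "\<And>x y1 y2. x \<in> X \<Longrightarrow> y1 \<in> Y \<Longrightarrow> y2 \<in> Y \<Longrightarrow>
           F (x, y1) - F (x, y2) - snd (D (x, y2)) \<bullet> (y1 - y2) \<le> - (\<mu>\<^sub>d / 2) * (nY (y1 - y2))\<^sup>2"
  shows "saddle_operator D w \<bullet> (w - zs) \<ge> \<mu> / 2 * (prod_norm nX nY (zs - w))\<^sup>2"
proof -
  obtain x y xs ys where eq: "w = (x, y)" "zs = (xs, ys)"
    by (metis surj_pair)
  have mem: "x \<in> X" "y \<in> Y" "xs \<in> X" "ys \<in> Y"
    and opt: "F (xs, y) \<le> F (xs, ys)" "F (xs, ys) \<le> F (x, ys)"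
    using sp w by (auto simp: eq saddle_point_def)
  have "\<mu> / 2 * (nX (xs - x))\<^sup>2 \<le> \<mu>\<^sub>p / 2 * (nX (xs - x))\<^sup>2"
    "\<mu> / 2 * (nY (ys - y))\<^sup>2 \<le> \<mu>\<^sub>d / 2 * (nY (ys - y))\<^sup>2"
    using mu by (auto intro!: mult_right_mono)
  with convF[OF mem(3,1,2)] concF[OF mem(1,4,2)] opt show ?thesis
    by (simp add: eq saddle_operator_def prod_norm_power2 inner_diff_right algebra_simps)
qed

section \<open>Contraction in one iteration and the linear rate\<close>

text \<open>Here \<open>u\<close>, \<open>v\<close>, \<open>p\<close> play the roles of \<open>z\<^sub>t\<close>, \<open>zhat\<^sub>t\<close>, \<open>z\<^sub>t\<^sub>+\<^sub>1\<close>.\<close>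

lemma REG_step_contraction:
  assumes N: "inner_product_norm N" and Z: "convex Z" "zs \<in> Z" and L: "L > 0" and mu: "\<mu> \<ge> 0"
    and v: "is_arg_min (\<lambda>w. 1 / L * (G u \<bullet> w) + 1/2 * (N (w - u))\<^sup>2) (\<lambda>w. w \<in> Z) v"
    and p: "is_arg_min (\<lambda>w. 1 / L * (G v \<bullet> w + \<mu>/2 * (N (w - v))\<^sup>2) + 1/2 * (N (w - u))\<^sup>2)
              (\<lambda>w. w \<in> Z) p"
    and lip: "(G v - G u) \<bullet> (v - p) \<le> L * N (v - u) * N (v - p)"
    and coercive: "G v \<bullet> (v - zs) \<ge> \<mu> / 2 * (N (zs - v))\<^sup>2"
  shows "(1 + \<mu> / L) * (N (p - zs))\<^sup>2 \<le> (N (u - zs))\<^sup>2"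
proof -
  have "p \<in> Z"
    using p by (simp add: is_arg_min_def)
  \<comment> \<open>The extrapolation step has a single quadratic term, so the second one gets
    weight \<open>0\<close> and the dummy centre \<open>0\<close>.\<close>
  have 1: "G u \<bullet> v / L + (N (v - u))\<^sup>2 / 2 + (N (p - v))\<^sup>2 / 2
             \<le> G u \<bullet> p / L + (N (p - u))\<^sup>2 / 2"
    using prox_three_point[OF N Z(1) \<open>p \<in> Z\<close>, of "(1 / L) *\<^sub>R G u" "1/2" u 0 0 v] v by simp
  have 2: "G v \<bullet> p / L + \<mu> / L / 2 * (N (p - v))\<^sup>2 + (N (p - u))\<^sup>2 / 2
             + (\<mu> / L / 2 + 1/2) * (N (zs - p))\<^sup>2
             \<le> G v \<bullet> zs / L + \<mu> / L / 2 * (N (zs - v))\<^sup>2 + (N (zs - u))\<^sup>2 / 2"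
    using prox_three_point[OF N Z, of "(1 / L) *\<^sub>R G v" "\<mu> / L / 2" v "1/2" u p] p
    by (simp add: algebra_simps)
  have 3: "G v \<bullet> v / L - G v \<bullet> p / L - G u \<bullet> v / L + G u \<bullet> p / L
             \<le> (N (v - u))\<^sup>2 / 2 + (N (p - v))\<^sup>2 / 2"
  proof -
    have "(G v - G u) \<bullet> (v - p) / L \<le> N (v - u) * N (v - p)"
      using lip L by (simp add: pos_divide_le_eq mult.commute mult.left_commute)
    also have "\<dots> \<le> (N (v - u))\<^sup>2 / 2 + (N (v - p))\<^sup>2 / 2"
      using sum_squares_bound[of "N (v - u)" "N (v - p)"] by simp
    finally have "(G v - G u) \<bullet> (v - p) / L \<le> (N (v - u))\<^sup>2 / 2 + (N (v - p))\<^sup>2 / 2" .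
    then show ?thesis
      by (simp add: inner_product_norm_minus_commute[OF N, of p v] inner_diff_left
          inner_diff_right diff_divide_distrib)
  qed
  have 4: "G v \<bullet> v / L - G v \<bullet> zs / L \<ge> \<mu> / L / 2 * (N (zs - v))\<^sup>2"
    using divide_right_mono[OF coercive, of L] L
    by (simp add: inner_diff_right diff_divide_distrib)
  have 5: "\<mu> / L / 2 * (N (p - v))\<^sup>2 \<ge> 0"
    using L mu by simp
  \<comment> \<open>In the sum of \<open>1\<close> to \<open>4\<close> all inner products and the
    terms in \<open>N (v - u)\<close>, \<open>N (p - u)\<close> and \<open>N (zs - v)\<close>
    cancel, as do the halves of \<open>(N (p - v))\<^sup>2\<close>; \<open>5\<close> discards what
    remains of the latter.\<close>
  from 1 2 3 4 5 have "(\<mu> / L / 2 + 1/2) * (N (zs - p))\<^sup>2 \<le> (N (zs - u))\<^sup>2 / 2"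
    by linarith
  then show ?thesis
    by (simp add: inner_product_norm_minus_commute[OF N, of zs] algebra_simps)
qed

theorem theorem3p1:
  fixes X :: "'a::euclidean_space set" and Y :: "'b::euclidean_space set"
    and nX :: "'a \<Rightarrow> real" and nY :: "'b \<Rightarrow> real"
    and F :: "'a \<times> 'b \<Rightarrow> real" and D :: "'a \<times> 'b \<Rightarrow> 'a \<times> 'b"
    and L \<mu>\<^sub>p \<mu>\<^sub>d \<mu> :: real and \<eta> :: "nat \<Rightarrow> real" and T :: nat
    and zs z0 :: "'a \<times> 'b" and z zhat :: "nat \<Rightarrow> 'a \<times> 'b"
  assumes "compact X" "convex X" "compact Y" "convex Y"
    and "inner_product_norm nX" "inner_product_norm nY"
    and "\<And>w. w \<in> X \<times> Y \<Longrightarrow> (F has_derivative (\<lambda>h. D w \<bullet> h)) (at w within X \<times> Y)"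
    and "L > 0"
    and "\<And>w w'. w \<in> X \<times> Y \<Longrightarrow> w' \<in> X \<times> Y \<Longrightarrow>
           dual_norm (prod_norm nX nY) (D w - D w') \<le> L * prod_norm nX nY (w - w')"
    and "\<mu>\<^sub>p > 0" "\<mu>\<^sub>d > 0" "\<mu> = min \<mu>\<^sub>p \<mu>\<^sub>d"
    and "\<And>x1 x2 y. x1 \<in> X \<Longrightarrow> x2 \<in> X \<Longrightarrow> y \<in> Y \<Longrightarrow>
           F (x1, y) - F (x2, y) - fst (D (x2, y)) \<bullet> (x1 - x2) \<ge> \<mu>\<^sub>p / 2 * (nX (x1 - x2))\<^sup>2"
    and "\<And>x y1 y2. x \<in> X \<Longrightarrow> y1 \<in> Y \<Longrightarrow> y2 \<in> Y \<Longrightarrow>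
           F (x, y1) - F (x, y2) - snd (D (x, y2)) \<bullet> (y1 - y2) \<le> - (\<mu>\<^sub>d / 2) * (nY (y1 - y2))\<^sup>2"
    and "saddle_point F X Y zs"
    and "z0 \<in> X \<times> Y" and "T > 0"
    and "\<And>t. t < T \<Longrightarrow> \<eta> t = 1 / L"
    and "REG_iterates (prod_norm nX nY) (X \<times> Y) (saddle_operator D) \<mu> \<eta> T z0 z zhat"
  shows "(prod_norm nX nY (z T - zs))\<^sup>2
           \<le> (1 + \<mu> / L) powi (- int T) * (prod_norm nX nY (z0 - zs))\<^sup>2"
proof -
  let ?N = "prod_norm nX nY" and ?Z = "X \<times> Y" and ?G = "saddle_operator D"
  define c where "c = 1 + \<mu> / L"
  note nXY = \<open>inner_product_norm nX\<close> \<open>inner_product_norm nY\<close>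
  have N: "inner_product_norm ?N"
    using nXY by (rule inner_product_norm_prod_norm)
  have Z: "convex ?Z" "zs \<in> ?Z"
    using assms by (auto simp: convex_Times saddle_point_def)
  have mu: "\<mu> > 0" "\<mu> \<le> \<mu>\<^sub>p" "\<mu> \<le> \<mu>\<^sub>d"
    using assms by auto
  have "c > 0"
    using \<open>L > 0\<close> mu by (simp add: c_def add_pos_pos)
  have z0: "z 0 = z0"
    and hat: "is_arg_min (\<lambda>w. 1 / L * (?G (z t) \<bullet> w) + 1/2 * (?N (w - z t))\<^sup>2)
         (\<lambda>w. w \<in> ?Z) (zhat t)"
    and nxt: "is_arg_min (\<lambda>w. 1 / L * (?G (zhat t) \<bullet> w + \<mu>/2 * (?N (w - zhat t))\<^sup>2)
                        + 1/2 * (?N (w - z t))\<^sup>2)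
         (\<lambda>w. w \<in> ?Z) (z (Suc t))" if "t < T" for t
    using \<open>REG_iterates ?N ?Z ?G \<mu> \<eta> T z0 z zhat\<close> \<open>\<And>t. t < T \<Longrightarrow> \<eta> t = 1 / L\<close>[OF that] that
    unfolding REG_iterates_def by auto
  have step: "c * (?N (z (Suc t) - zs))\<^sup>2 \<le> (?N (z t - zs))\<^sup>2" if t: "t < T" and zt: "z t \<in> ?Z" for t
    unfolding c_def
  proof (rule REG_step_contraction[OF N Z \<open>L > 0\<close> less_imp_le[OF mu(1)] hat[OF t] nxt[OF t]])
    have zh: "zhat t \<in> ?Z"
      using hat[OF t] by (simp add: is_arg_min_def)
    have "dual_norm ?N (D (zhat t) - D (z t)) \<le> L * ?N (zhat t - z t)"
      using zh zt by (rule assms(9))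
    then show "(?G (zhat t) - ?G (z t)) \<bullet> (zhat t - z (Suc t))
        \<le> L * ?N (zhat t - z t) * ?N (zhat t - z (Suc t))"
      using saddle_operator_inner_le_dual_norm[OF nXY, of D "zhat t" "z t" "zhat t - z (Suc t)"]
        inner_product_norm_nonneg[OF N]
      by (meson mult_right_mono order_trans)
    show "?G (zhat t) \<bullet> (zhat t - zs) \<ge> \<mu> / 2 * (?N (zs - zhat t))\<^sup>2"
      using \<open>saddle_point F X Y zs\<close> zh mu(2,3) assms(13,14)
      by (rule saddle_operator_strongly_coercive)
  qed
  \<comment> \<open>Membership is carried along because the Lipschitz bound used in
    \<open>step\<close> holds on \<open>X \<times> Y\<close> only; each new iterate inherits it as a
    constrained minimiser.\<close>
  have "z t \<in> ?Z \<and> c ^ t * (?N (z t - zs))\<^sup>2 \<le> (?N (z0 - zs))\<^sup>2" if "t \<le> T" for t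
    using that
  proof (induction t)
    case 0
    then show ?case using z0[OF \<open>T > 0\<close>] \<open>z0 \<in> ?Z\<close> by simp
  next
    case (Suc t)
    then have t: "t < T" and IH: "z t \<in> ?Z" "c ^ t * (?N (z t - zs))\<^sup>2 \<le> (?N (z0 - zs))\<^sup>2"
      by auto
    have "c ^ t * (c * (?N (z (Suc t) - zs))\<^sup>2) \<le> c ^ t * (?N (z t - zs))\<^sup>2"
      using \<open>c > 0\<close> by (intro mult_left_mono step[OF t IH(1)]) simp
    with IH(2) nxt[OF t] show ?case
      by (simp add: is_arg_min_def mult.assoc mult.left_commute)
  qed
  from this[of T] have "(?N (z T - zs))\<^sup>2 \<le> (?N (z0 - zs))\<^sup>2 / c ^ T"
    using \<open>c > 0\<close> by (simp add: pos_le_divide_eq mult.commute)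
  then show ?thesis
    by (simp add: c_def power_int_minus divide_inverse mult.commute)
qed

end
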